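(* Let $\lambda_0,\lambda_1,\lambda_2\in\mathbb{Z}$ be distinct. Then the Sidon constant of $\Lambda=\{\lambda_0,\lambda_1,\lambda_2\}$ is $\sec(\pi/2n)=1/\cos\bigl(\tfrac{\pi}{2n}\bigr)$, where $$n=\frac{\max_{i,j}|\lambda_i-\lambda_j|}{\gcd(\lambda_1-\lambda_0,\lambda_2-\lambda_0)}.$$
   Context: Let $\Lambda\subseteq\mathbb{Z}$. $\Lambda$ is a Sidon set if there is a constant $C$ such that for all trigonometric polynomials $f(t)=\sum_{\lambda\in\Lambda}c_\lambda e^{i\lambda t}$ (finite sums, $c_\lambda\in\mathbb{C}$) with spectrum in $\Lambda$ one has $$\|\widehat f\|_1=\sum_{\lambda\in\Lambda}|c_\lambda|\le C\max_{t\in\mathbb{R}}|f(t)|=C\|f\|_\infty.$$ The optimal (smallest) such $C$ is called the Sidon constant of $\Lambda$. The gcd is taken to be positive. *)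

theory Defs
  imports "HOL-Analysis.Analysis"
begin

definition trig_poly :: "int set \<Rightarrow> (int \<Rightarrow> complex) \<Rightarrow> real \<Rightarrow> complex" where
  "trig_poly S c t = (\<Sum>k\<in>S. c k * exp (\<i> * of_int k * of_real t))"

(* For finite S the function below is continuous and 2*pi-periodic, so the supremum is
   a maximum. *)
definition sup_norm :: "(real \<Rightarrow> complex) \<Rightarrow> real" where
  "sup_norm f = (SUP t. cmod (f t))"

(* L may be infinite, so a polynomial with spectrum in L is given by a finite S \<subseteq> L and
   coefficients on S; distinct frequencies are linearly independent, so the left-hand sum
   is the l1 norm of the Fourier transform of trig_poly S c. *)
definition sidon_bound :: "int set \<Rightarrow> real \<Rightarrow> bool" where
  "sidon_bound L C \<longleftrightarrow>
     (\<forall>S c. finite S \<and> S \<subseteq> L \<longrightarrow>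
        (\<Sum>k\<in>S. cmod (c k)) \<le> C * sup_norm (trig_poly S c))"

definition sidon_set :: "int set \<Rightarrow> bool" where
  "sidon_set L \<longleftrightarrow> (\<exists>C. sidon_bound L C)"

(* A relation rather than an Inf or LEAST term, so that it carries existence and attainment:
   is_sidon_constant L C implies sidon_set L, and it determines C uniquely. *)
definition is_sidon_constant :: "int set \<Rightarrow> real \<Rightarrow> bool" where
  "is_sidon_constant L C \<longleftrightarrow> sidon_bound L C \<and> (\<forall>C'. sidon_bound L C' \<longrightarrow> C \<le> C')"

end

theory Submission
  imports Defs
begin

text \<open>
  Let \<open>a < b < c\<close> be the frequencies, \<open>p = b - a\<close>, \<open>q = c - b\<close>, \<open>g = gcd p q\<close>, so that
  \<open>n = (p + q) / g\<close>. Dividing by the middle character, the modulus to study is that of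
  \<open>r + s e\<^sup>i\<^sup>x + u e\<^sup>i\<^sup>y\<close> with \<open>r, s, u \<ge> 0\<close>, where \<open>(x, y)\<close> runs over a line
  \<open>(q/g) x + (p/g) y = \<delta>\<close> modulo \<open>2 \<pi>\<close>; one may take \<open>\<bar>\<delta>\<bar> \<le> \<pi>\<close>. At \<open>x = y = \<delta>/n\<close> the modulus
  is at least \<open>(r + s + u) cos (\<delta>/2n)\<close>, which gives the upper bound on the Sidon constant.
  It is attained for \<open>\<delta> = \<pi>\<close> and \<open>(s, r, u) = (q, p + q, p)\<close>: with these weights, the derivative
  of the squared modulus along the line is a multiple of \<open>sin ((x - y)/2) cos (x/2) cos (y/2)\<close>,
  so that the maximum is at \<open>x = y\<close> or at \<open>x = \<pi>\<close> or at \<open>y = \<pi>\<close>, modulo \<open>2 \<pi>\<close>.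
  In the first case \<open>x\<close> is an odd multiple of \<open>\<pi>/n\<close>, and in the other two the modulus is at most
  \<open>2 p\<close> or \<open>2 q\<close>, which is small enough because \<open>n - 1 \<le> n cos (\<pi>/2n)\<close>.
\<close>

section \<open>Sums of three unimodular numbers with weights\<close>

text \<open>With \<open>x = u - p * t\<close> and \<open>y = v + q * t\<close>, the combination
  \<open>q * x + p * y\<close> does not depend on \<open>t\<close>. A diagonal point
  \<open>x = y = \<theta>\<close> modulo \<open>2 * pi\<close> therefore forces
  \<open>(p + q) * \<theta> = q * u + p * v\<close> modulo \<open>2 * pi\<close>; coprimality makes
  every such \<open>\<theta>\<close> reachable.\<close>

lemma coprime_line_meets_diagonal:
  fixes p q :: int and u v :: real
  assumes "p > 0" "q > 0" "coprime p q"
  obtains t \<theta> :: real and k l :: int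
  where "\<bar>\<theta>\<bar> \<le> pi / (p + q)" "u - p * t = \<theta> + 2 * pi * k" "v + q * t = \<theta> + 2 * pi * l"
proof -
  obtain i j where ij: "i * q + j * p = 1"
    using assms(3) bezout_int[of q p] by (auto simp: coprime_iff_gcd_eq_1 gcd.commute)
  \<comment> \<open>Rounding to the nearest multiple of \<open>2 * pi\<close> makes
    \<open>\<theta>\<close> as small as possible. Bezout then splits \<open>m\<close> as
    \<open>q * k + p * l\<close>; \<open>t\<close> comes from subtracting the two target equations,
    \<open>\<theta>\<close> from their weighted sum.\<close>
  define m where "m = round ((q * u + p * v) / (2 * pi))"
  define k where "k = m * i"
  define l where "l = m * j"
  define n where "n = real_of_int (p + q)"
  define \<theta> where "\<theta> = (q * u + p * v - 2 * pi * m) / n"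
  define t where "t = (u - v - 2 * pi * (k - l)) / n"
  have "m = q * k + p * l"
    unfolding k_def l_def using ij by (metis mult.assoc mult.commute mult.right_neutral distrib_left)
  then have m: "real_of_int m = q * k + p * l"
    by simp
  have n: "n > 0" "n = p + q"
    using assms by (auto simp: n_def)
  have "\<bar>(q * u + p * v) / (2 * pi) - m\<bar> \<le> 1 / 2"
    unfolding m_def using of_int_round_abs_le by (metis abs_minus_commute)
  then have "\<bar>(q * u + p * v) / (2 * pi) - m\<bar> * (2 * pi) \<le> pi"
    by (simp add: field_simps)
  then have "\<bar>((q * u + p * v) / (2 * pi) - m) * (2 * pi)\<bar> \<le> pi"
    by (simp add: abs_mult)
  moreover have "((q * u + p * v) / (2 * pi) - m) * (2 * pi) = q * u + p * v - 2 * pi * m"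
    by (simp add: field_simps)
  ultimately have "\<bar>\<theta>\<bar> \<le> pi / n"
    using n by (simp add: \<theta>_def divide_right_mono)
  moreover have "u - p * t = \<theta> + 2 * pi * k" "v + q * t = \<theta> + 2 * pi * l"
    using n(1) unfolding t_def \<theta>_def m by (simp_all add: field_simps) (simp_all add: n(2) algebra_simps)
  ultimately show thesis
    using that n(2) by simp
qed

lemma cis_add_2pi_int: "cis (x + 2 * pi * of_int k) = cis x"
  by (simp flip: cis_mult add: cis_multiple_2pi)

text \<open>Rotating by half the angle gives both unimodular factors the same real part
  \<open>cos (\<theta> / 2)\<close>.\<close>

lemma cmod_add_cis_ge:
  assumes "r \<ge> 0" "s \<ge> 0"
  shows "(r + s) * cos (\<theta> / 2) \<le> cmod (of_real r + of_real s * cis \<theta>)"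
proof -
  have "cmod (of_real r + of_real s * cis \<theta>) = cmod (cis (- \<theta> / 2) * (of_real r + of_real s * cis \<theta>))"
    by (simp add: norm_mult)
  also have "cis (- \<theta> / 2) * (of_real r + of_real s * cis \<theta>)
      = of_real r * cis (- \<theta> / 2) + of_real s * cis (\<theta> / 2)"
    by (simp add: algebra_simps cis_mult)
  finally show ?thesis
    using complex_Re_le_cmod[of "of_real r * cis (- \<theta> / 2) + of_real s * cis (\<theta> / 2)"]
    by (simp add: algebra_simps)
qed

lemma trinomial_large_value:
  fixes p q :: int and z0 z1 z2 :: complex
  assumes "p > 0" "q > 0"
  shows "\<exists>t::real. (cmod z0 + cmod z1 + cmod z2) * cos (pi * gcd p q / (2 * (p + q)))
             \<le> cmod (z0 * cis (- of_int p * t) + z1 + z2 * cis (q * t))"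
proof -
  define g where "g = gcd p q"
  have g: "g > 0"
    using assms by (simp add: g_def)
  obtain p' q' where pq: "p = g * p'" "q = g * q'" "coprime p' q'"
    using gcd_coprime_exists[of p q] g unfolding g_def by (metis less_irrefl mult.commute)
  have pos: "p' > 0" "q' > 0"
    using assms g pq by (simp_all add: zero_less_mult_iff)
  obtain s \<theta> :: real and k l :: int
    where th: "\<bar>\<theta>\<bar> \<le> pi / (p' + q')"
      and k: "(Arg z0 - Arg z1) - p' * s = \<theta> + 2 * pi * k"
      and l: "(Arg z2 - Arg z1) + q' * s = \<theta> + 2 * pi * l"
    by (rule coprime_line_meets_diagonal[OF pos pq(3), where u = "Arg z0 - Arg z1"
          and v = "Arg z2 - Arg z1"])
  have z: "z = of_real (cmod z) * cis (Arg z)" for z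
    by (metis rcis_cmod_Arg rcis_def)
  \<comment> \<open>The time is \<open>s / g\<close> because the frequencies are \<open>g\<close>
    times the coprime \<open>p'\<close> and \<open>q'\<close>.\<close>
  have "z0 * cis (- of_int p * (s / g)) = of_real (cmod z0) * cis (Arg z0 - p' * s)"
    by (subst z) (use g in \<open>simp add: pq cis_mult mult.assoc\<close>)
  also have "Arg z0 - p' * s = (Arg z1 + \<theta>) + 2 * pi * k"
    using k by simp
  finally have e0: "z0 * cis (- of_int p * (s / g)) = of_real (cmod z0) * cis (Arg z1 + \<theta>)"
    by (simp only: cis_add_2pi_int)
  have "z2 * cis (q * (s / g)) = of_real (cmod z2) * cis (Arg z2 + q' * s)"
    by (subst z) (use g in \<open>simp add: pq cis_mult mult.assoc\<close>)
  also have "Arg z2 + q' * s = (Arg z1 + \<theta>) + 2 * pi * l"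
    using l by simp
  finally have e2: "z2 * cis (q * (s / g)) = of_real (cmod z2) * cis (Arg z1 + \<theta>)"
    by (simp only: cis_add_2pi_int)
  have "z0 * cis (- of_int p * (s / g)) + z1 + z2 * cis (q * (s / g))
      = cis (Arg z1) * (of_real (cmod z1) + of_real (cmod z0 + cmod z2) * cis \<theta>)"
    unfolding e0 e2 by (subst (3) z) (simp add: algebra_simps flip: cis_mult)
  then have "cmod (z0 * cis (- of_int p * (s / g)) + z1 + z2 * cis (q * (s / g)))
      = cmod (of_real (cmod z1) + of_real (cmod z0 + cmod z2) * cis \<theta>)"
    by (simp only: norm_mult norm_cis mult_1)
  also have "\<dots> \<ge> (cmod z1 + (cmod z0 + cmod z2)) * cos (\<theta> / 2)"
    by (rule cmod_add_cis_ge) auto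
  finally have *: "(cmod z0 + cmod z1 + cmod z2) * cos (\<theta> / 2)
      \<le> cmod (z0 * cis (- of_int p * (s / g)) + z1 + z2 * cis (q * (s / g)))"
    by (simp add: algebra_simps)
  have "p + q = g * (p' + q')"
    by (simp add: pq distrib_left)
  define w where "w = pi / (p' + q')"
  have "pi * gcd p q / (2 * (p + q)) = w / 2"
    using g unfolding g_def[symmetric] \<open>p + q = _\<close> w_def by (simp only: of_int_mult) simp
  moreover have "cos (w / 2) \<le> cos (\<bar>\<theta>\<bar> / 2)"
  proof (rule cos_monotone_0_pi_le)
    have "w \<le> pi / 1"
      unfolding w_def using pos by (intro divide_left_mono) auto
    then show "w / 2 \<le> pi"
      using pi_ge_zero by linarith
  qed (use th[folded w_def] in auto)
  moreover have "cos (\<bar>\<theta>\<bar> / 2) = cos (\<theta> / 2)"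
    by (metis abs_divide abs_numeral cos_abs_real)
  ultimately have "cos (pi * gcd p q / (2 * (p + q))) \<le> cos (\<theta> / 2)"
    by (simp only:)
  then have "(cmod z0 + cmod z1 + cmod z2) * cos (pi * gcd p q / (2 * (p + q)))
      \<le> (cmod z0 + cmod z1 + cmod z2) * cos (\<theta> / 2)"
    by (rule mult_left_mono) simp
  then show ?thesis
    using * order_trans by blast
qed

section \<open>The extremal trinomial\<close>

text \<open>Reducing \<open>j\<close> modulo \<open>2 * n\<close> into \<open>[-n, n]\<close>
  preserves its parity, so the residue is nonzero, and cosine decreases on
  \<open>[0, pi]\<close>.\<close>

lemma cos_odd_multiple_le:
  fixes j n :: int
  assumes "odd j" "n > 0"
  shows "cos (j * pi / n) \<le> cos (pi / n)"
proof -
  define m where "m = round (real_of_int j / (2 * n))"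
  define j' where "j' = j - 2 * m * n"
  have "\<bar>j / (2 * n) - m\<bar> \<le> 1 / 2"
    unfolding m_def using of_int_round_abs_le by (metis abs_minus_commute)
  then have "\<bar>j / (2 * n) - m\<bar> * (2 * n) \<le> n"
    using assms by (simp add: field_simps)
  then have "\<bar>(j / (2 * n) - m) * (2 * n)\<bar> \<le> n"
    using assms by (simp add: abs_mult)
  moreover have "(j / (2 * n) - m) * (2 * n) = j'"
    using assms by (simp add: field_simps j'_def)
  ultimately have up: "\<bar>real_of_int j'\<bar> \<le> n"
    by simp
  have "odd j'"
    using assms by (simp add: j'_def)
  then have "\<bar>j'\<bar> \<ge> 1"
    by presburger
  then have lo: "\<bar>real_of_int j'\<bar> \<ge> 1"
    by linarith
  have "j * pi / n = j' * pi / n + 2 * pi * m"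
    using assms by (simp add: field_simps j'_def)
  then have "cos (j * pi / n) = cos (j' * pi / n)"
    using arg_cong[OF cis_add_2pi_int[of "j' * pi / n" m], of Re] by simp
  also have "\<dots> = cos (\<bar>j' * pi / n\<bar>)"
    by (simp only: cos_abs_real)
  also have "\<bar>j' * pi / n\<bar> = \<bar>real_of_int j'\<bar> * pi / n"
    using assms by (simp add: abs_mult)
  also have "cos (\<bar>real_of_int j'\<bar> * pi / n) \<le> cos (pi / n)"
    using assms up lo by (intro cos_monotone_0_pi_le) (auto simp: divide_simps)
  finally show ?thesis .
qed

text \<open>Since \<open>1 - cos (2 * a) = 2 * (sin a)^2\<close> is at most \<open>2 * a^2\<close>,
  the deficit is at most \<open>pi^2 / (8 * n)\<close>; the crude \<open>pi < 4\<close> suffices for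
  \<open>n \<ge> 2\<close>.\<close>

lemma pred_le_mult_cos:
  fixes n :: real
  assumes "n \<ge> 2"
  shows "n - 1 \<le> n * cos (pi / (2 * n))"
proof -
  have "1 - cos (pi / (2 * n)) = 2 * (sin (pi / (4 * n)))\<^sup>2"
    using cos_double_sin[of "pi / (4 * n)"] by simp
  also have "(sin (pi / (4 * n)))\<^sup>2 \<le> (pi / (4 * n))\<^sup>2"
    using abs_sin_x_le_abs_x by (simp only: abs_le_square_iff)
  finally have "n * (1 - cos (pi / (2 * n))) \<le> n * (2 * (pi / (4 * n))\<^sup>2)"
    using assms by (intro mult_left_mono) auto
  also have "\<dots> = pi\<^sup>2 / (8 * n)"
    using assms by (simp add: field_simps power2_eq_square)
  also have "\<dots> \<le> 1"
  proof -
    have "pi\<^sup>2 \<le> 4\<^sup>2"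
      using pi_less_4 by (intro power_mono) auto
    then show ?thesis
      using assms by simp
  qed
  finally show ?thesis
    by (simp add: algebra_simps)
qed

lemma cmod_sum3_cis_sq:
  "(cmod (of_real r + of_real s * cis x + of_real u * cis y))\<^sup>2
     = r\<^sup>2 + s\<^sup>2 + u\<^sup>2 + 2 * r * s * cos x + 2 * r * u * cos y + 2 * s * u * cos (x - y)"
proof -
  have "(r + s * cos x + u * cos y)\<^sup>2 + (s * sin x + u * sin y)\<^sup>2
      = r\<^sup>2 + s\<^sup>2 * ((sin x)\<^sup>2 + (cos x)\<^sup>2) + u\<^sup>2 * ((sin y)\<^sup>2 + (cos y)\<^sup>2)
        + 2 * r * s * cos x + 2 * r * u * cos y + 2 * s * u * cos (x - y)"
    unfolding cos_diff by algebra
  then show ?thesis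
    by (simp add: cmod_power2)
qed

text \<open>This factorization sorts the critical points of the extremal trinomial into three
  families.\<close>

lemma sin_diff_add_sin_diff:
  fixes x y :: real
  shows "sin x - sin y + sin (x - y) = 4 * sin ((x - y) / 2) * cos (x / 2) * cos (y / 2)"
proof -
  define X where "X = x / 2"
  define Y where "Y = y / 2"
  have "sin (2 * X) - sin (2 * Y) + sin (2 * (X - Y)) = 4 * sin (X - Y) * cos X * cos Y"
    using sin_cos_squared_add[of X] sin_cos_squared_add[of Y]
    unfolding sin_double cos_diff sin_diff by algebra
  then show ?thesis
    by (simp add: X_def Y_def diff_divide_distrib)
qed

lemma cos_eq_minus1_of_cos_half:
  fixes x :: real
  assumes "cos (x / 2) = 0"
  shows "cos x = -1"
  using cos_double_cos[of "x / 2"] assms by simp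

text \<open>Equal outer phases \<open>w\<close> put the orbit on the line with constant
  \<open>pi\<close>, farthest from the aligned position. \<open>G\<close> below is the squared
  modulus and \<open>B\<close> the square of the claimed bound.\<close>

lemma extremal_trinomial_le:
  fixes p q :: int and t w :: real
  assumes "p > 0" "q > 0"
  defines "w \<equiv> pi * gcd p q / (p + q)"
  shows "cmod (of_int q * cis (w - p * t) + of_int (p + q) + of_int p * cis (w + q * t))
     \<le> 2 * (p + q) * cos (w / 2)"
proof -
  define g where "g = gcd p q"
  have g: "g > 0"
    using assms by (simp add: g_def)
  obtain p' q' where pq: "p = g * p'" "q = g * q'"
    unfolding g_def by (metis gcd_dvd1 gcd_dvd2 dvdE)
  have pos: "p' > 0" "q' > 0"
    using assms g pq by (simp_all add: zero_less_mult_iff)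
  have sum_eq: "p + q = g * (p' + q')"
    by (simp add: pq distrib_left)
  have w: "w = pi / (p' + q')"
    using g unfolding w_def g_def[symmetric] sum_eq by (simp only: of_int_mult) simp
  define x where "x t = w - p * t" for t :: real
  define y where "y t = w + q * t" for t :: real
  define P where "P = real_of_int p"
  define Q where "Q = real_of_int q"
  have PQ: "P > 0" "Q > 0"
    using assms by (auto simp: P_def Q_def)
  define G where "G t = (P + Q)\<^sup>2 + Q\<^sup>2 + P\<^sup>2 + 2 * (P + Q) * Q * cos (x t)
     + 2 * (P + Q) * P * cos (y t) + 2 * Q * P * cos (x t - y t)" for t
  define B where "B = 2 * (P + Q)\<^sup>2 * (1 + cos w)"
  have B: "B = (2 * (P + Q) * cos (w / 2))\<^sup>2"
    using cos_double_cos[of "w / 2"] by (simp add: B_def power2_eq_square algebra_simps)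
  have c: "p' + q' - 1 \<le> (p' + q') * cos (w / 2)"
    using pos pred_le_mult_cos[of "of_int (p' + q')"] by (simp add: w mult.commute)
  moreover have "real_of_int p' \<ge> 1" "real_of_int q' \<ge> 1"
    using pos by auto
  ultimately have "0 \<le> (p' + q') * cos (w / 2)"
    by linarith
  then have cos_ge_0: "cos (w / 2) \<ge> 0"
    using pos by (simp add: zero_le_mult_iff)
  \<comment> \<open>Bounds the critical values with \<open>x\<close> or \<open>y\<close> equal to
    \<open>pi\<close>: both \<open>P\<close> and \<open>Q\<close> are at most
    \<open>g * (p' + q' - 1)\<close>.\<close>
  have small: "2 * r\<^sup>2 * (1 + cos z) \<le> B" if "r = P \<or> r = Q" for r z
  proof -
    have "g * real_of_int (p' + q' - 1) \<le> g * ((p' + q') * cos (w / 2))"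
      using c g by (intro mult_left_mono) auto
    moreover have "g * ((p' + q') * cos (w / 2)) = (P + Q) * cos (w / 2)"
      by (simp add: P_def Q_def pq algebra_simps)
    moreover have "r \<le> g * real_of_int (p' + q' - 1)"
      using that pos g by (auto simp: P_def Q_def pq mult_left_mono)
    ultimately have "2 * r \<le> 2 * (P + Q) * cos (w / 2)"
      by linarith
    then have "(2 * r)\<^sup>2 \<le> (2 * (P + Q) * cos (w / 2))\<^sup>2"
      by (rule power_mono) (use that PQ in auto)
    then have "4 * r\<^sup>2 \<le> B"
      by (simp only: B power_mult_distrib) simp
    moreover have "2 * r\<^sup>2 * (1 + cos z) \<le> 2 * r\<^sup>2 * 2"
      by (intro mult_left_mono) auto
    ultimately show ?thesis
      by linarith
  qed
  have deriv: "(G has_real_derivative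
      2 * P * Q * (P + Q) * (sin (x t) - sin (y t) + sin (x t - y t))) (at t)" for t
    unfolding G_def x_def y_def P_def[symmetric] Q_def[symmetric]
    by (auto intro!: derivative_eq_intros simp: algebra_simps power2_eq_square)
  have "\<exists>t0\<in>{0..2 * pi}. \<forall>t\<in>{0..2 * pi}. G t \<le> G t0"
    by (rule continuous_attains_sup)
      (auto intro: continuous_at_imp_continuous_on DERIV_isCont deriv)
  then obtain t0 where t0: "G t \<le> G t0" if "t \<in> {0..2 * pi}" for t
    by blast
  \<comment> \<open>Periodicity makes the maximum global, so the derivative vanishes at
    \<open>t0\<close> even if it is an endpoint of the interval.\<close>
  have max: "G t \<le> G t0" for t
  proof -
    define m where "m = \<lfloor>t / (2 * pi)\<rfloor>"
    define s where "s = t - 2 * pi * m"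
    have "of_int m \<le> t / (2 * pi)" "t / (2 * pi) < of_int m + 1"
      unfolding m_def by linarith+
    then have s: "s \<in> {0..2 * pi}"
      by (auto simp: s_def field_simps)
    have per: "cos (z + 2 * pi * of_int j) = cos z" for z j
      using arg_cong[OF cis_add_2pi_int[of z j], of Re] by simp
    have "x t = x s + 2 * pi * of_int (- p * m)" "y t = y s + 2 * pi * of_int (q * m)"
      "x t - y t = (x s - y s) + 2 * pi * of_int (- (p + q) * m)"
      by (simp_all add: x_def y_def s_def algebra_simps)
    then have "cos (x t) = cos (x s)" "cos (y t) = cos (y s)" "cos (x t - y t) = cos (x s - y s)"
      by (simp_all only: per)
    then have "G t = G s"
      by (simp add: G_def)
    then show ?thesis
      using t0[OF s] by simp
  qed
  have "2 * P * Q * (P + Q) * (sin (x t0) - sin (y t0) + sin (x t0 - y t0)) = 0"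
    using DERIV_local_max[OF deriv zero_less_one] max by blast
  then have crit: "sin ((x t0 - y t0) / 2) = 0 \<or> cos (x t0 / 2) = 0 \<or> cos (y t0 / 2) = 0"
    using PQ by (auto simp: sin_diff_add_sin_diff)
  have "G t0 \<le> B"
    using crit
  proof (elim disjE)
    assume "sin ((x t0 - y t0) / 2) = 0"
    then obtain k :: int where "(x t0 - y t0) / 2 = k * pi"
      by (auto simp: sin_zero_iff_int2)
    then have k: "x t0 = y t0 + 2 * pi * k" "(P + Q) * t0 = - 2 * pi * k"
      by (auto simp: x_def y_def P_def Q_def algebra_simps)
    then have cxy: "cos (x t0) = cos (y t0)" "cos (x t0 - y t0) = 1"
      using arg_cong[OF cis_add_2pi_int[of "y t0" k], of Re]
        arg_cong[OF cis_add_2pi_int[of 0 k], of Re] by simp_all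
    have t0_eq: "t0 = - 2 * pi * k / (P + Q)"
      using k(2) PQ by (simp add: field_simps)
    have "P + Q = g * (p' + q')" "P = g * p'"
      by (simp_all add: P_def Q_def pq distrib_left)
    then have "p * t0 = - 2 * k * p' * pi / (p' + q')"
      using g unfolding t0_eq P_def[symmetric] by simp
    then have "x t0 = of_int (1 + 2 * k * p') * pi / of_int (p' + q')"
      by (simp add: x_def w field_simps add_divide_distrib)
    then have "cos (x t0) \<le> cos w"
      using cos_odd_multiple_le[of "1 + 2 * k * p'" "p' + q'"] pos by (simp add: w)
    then have "2 * (P + Q)\<^sup>2 * (1 + cos (x t0)) \<le> B"
      unfolding B_def by (intro mult_left_mono) auto
    moreover have "G t0 = 2 * (P + Q)\<^sup>2 * (1 + cos (x t0))"
      unfolding G_def cxy by algebra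
    ultimately show ?thesis
      by simp
  next
    assume "cos (x t0 / 2) = 0"
    then have cx: "cos (x t0) = -1"
      by (rule cos_eq_minus1_of_cos_half)
    then have "sin (x t0) = 0"
      using sin_cos_squared_add[of "x t0"] by simp
    \<comment> \<open>Here \<open>cis (x t0) = -1\<close> cancels \<open>Q\<close> against the
      middle weight, leaving \<open>P * (1 + cis (y t0))\<close>.\<close>
    then have "G t0 = 2 * P\<^sup>2 * (1 + cos (y t0))"
      unfolding G_def cos_diff cx by algebra
    then show ?thesis
      using small by simp
  next
    assume "cos (y t0 / 2) = 0"
    then have cy: "cos (y t0) = -1"
      by (rule cos_eq_minus1_of_cos_half)
    then have "sin (y t0) = 0"
      using sin_cos_squared_add[of "y t0"] by simp
    then have "G t0 = 2 * Q\<^sup>2 * (1 + cos (x t0))"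
      unfolding G_def cos_diff cy by algebra
    then show ?thesis
      using small by simp
  qed
  then have "G t \<le> (2 * (P + Q) * cos (w / 2))\<^sup>2"
    using max[of t] B by simp
  moreover have "G t = (cmod (of_real (P + Q) + of_real Q * cis (x t) + of_real P * cis (y t)))\<^sup>2"
    by (simp only: cmod_sum3_cis_sq G_def)
  moreover have "0 \<le> 2 * (P + Q) * cos (w / 2)"
    using PQ cos_ge_0 by simp
  ultimately have "cmod (of_real (P + Q) + of_real Q * cis (x t) + of_real P * cis (y t))
      \<le> 2 * (P + Q) * cos (w / 2)"
    by (metis power2_le_imp_le)
  then show ?thesis
    by (simp add: P_def Q_def x_def y_def algebra_simps)
qed

section \<open>The Sidon constant\<close>

lemma sup_norm_upper:
  assumes "finite S"
  shows "cmod (trig_poly S c t) \<le> sup_norm (trig_poly S c)"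
  unfolding sup_norm_def
proof (rule cSUP_upper)
  have "cmod (trig_poly S c t) \<le> (\<Sum>k\<in>S. cmod (c k))" for t
    unfolding trig_poly_def by (rule sum_norm_le) (simp add: norm_mult)
  then show "bdd_above (range (\<lambda>t. cmod (trig_poly S c t)))"
    by (intro bdd_aboveI2)
qed auto

text \<open>Extending coefficients by zero from \<open>S\<close> to \<open>L\<close> changes neither
  side of the inequality.\<close>

lemma sidon_bound_finiteI:
  assumes "finite L"
    and "\<And>c. (\<Sum>k\<in>L. cmod (c k)) \<le> C * sup_norm (trig_poly L c)"
  shows "sidon_bound L C"
  unfolding sidon_bound_def
proof (intro allI impI)
  fix S and c :: "int \<Rightarrow> complex"
  assume S: "finite S \<and> S \<subseteq> L"
  define c' where "c' k = (if k \<in> S then c k else 0)" for k :: int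
  have "(\<Sum>k\<in>S. cmod (c k)) = (\<Sum>k\<in>L. cmod (c' k))"
    using S assms(1) by (intro sum.mono_neutral_cong_left) (auto simp: c'_def)
  also have "\<dots> \<le> C * sup_norm (trig_poly L c')"
    by (rule assms(2))
  also have "trig_poly L c' t = trig_poly S c t" for t
    unfolding trig_poly_def using S assms(1)
    by (intro sum.mono_neutral_cong_right) (auto simp: c'_def)
  then have "trig_poly L c' = trig_poly S c"
    by blast
  finally show "(\<Sum>k\<in>S. cmod (c k)) \<le> C * sup_norm (trig_poly S c)" .
qed

lemma cmod_trig_poly3:
  assumes "distinct [l0, l1, l2]"
  shows "cmod (trig_poly {l0, l1, l2} c t)
    = cmod (c l0 * cis (- of_int (l1 - l0) * t) + c l1 + c l2 * cis (of_int (l2 - l1) * t))"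
proof -
  have e: "exp (\<i> * of_int k * of_real t) = cis (of_int k * t)" for k
    by (simp add: cis_conv_exp mult.assoc)
  have "trig_poly {l0, l1, l2} c t = cis (l1 * t) *
      (c l0 * cis (- of_int (l1 - l0) * t) + c l1 + c l2 * cis (of_int (l2 - l1) * t))"
    using assms unfolding trig_poly_def e
    by (simp add: distrib_left cis_mult mult.left_commute left_diff_distrib add.assoc)
  then show ?thesis
    by (simp only: norm_mult norm_cis mult_1)
qed

lemma is_sidon_constant_ordered:
  fixes l0 l1 l2 :: int
  assumes "l0 < l1" "l1 < l2"
  shows "is_sidon_constant {l0, l1, l2}
           (1 / cos (pi * gcd (l1 - l0) (l2 - l1) / (2 * (l2 - l0))))"
proof -
  define p where "p = l1 - l0"
  define q where "q = l2 - l1"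
  define L where "L = {l0, l1, l2}"
  have pos: "p > 0" "q > 0"
    using assms by (auto simp: p_def q_def)
  have d: "distinct [l0, l1, l2]"
    using assms by simp
  have [simp]: "finite L"
    by (simp add: L_def)
  have sumL: "(\<Sum>k\<in>L. f k) = f l0 + f l1 + f l2" for f :: "int \<Rightarrow> real"
    using assms by (simp add: L_def)
  note poly = cmod_trig_poly3[OF d, folded L_def p_def q_def]
  define v where "v = pi * gcd p q / (2 * (p + q))"
  have "gcd p q \<le> p"
    using pos by (simp add: zdvd_imp_le)
  then have "gcd p q < p + q" "gcd p q > 0"
    using pos by (linarith, simp)
  then have "real_of_int (gcd p q) < real_of_int (p + q)" "real_of_int (gcd p q) > 0"
    by (simp_all only: of_int_less_iff of_int_0_less_iff)
  \<comment> \<open>The strict inequality \<open>gcd p q < p + q\<close> keeps \<open>v\<close>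
    below \<open>pi / 2\<close>.\<close>
  then have v: "cos v > 0"
    using pos unfolding v_def by (intro cos_gt_zero) (auto simp: divide_simps)
  have "sidon_bound L (1 / cos v)"
  proof (rule sidon_bound_finiteI)
    fix c
    obtain t :: real where "(cmod (c l0) + cmod (c l1) + cmod (c l2)) * cos v
        \<le> cmod (c l0 * cis (- of_int p * t) + c l1 + c l2 * cis (q * t))"
      using trinomial_large_value[OF pos] unfolding v_def by blast
    also have "\<dots> \<le> sup_norm (trig_poly L c)"
      using sup_norm_upper[of L c t] by (simp only: poly \<open>finite L\<close>)
    finally show "(\<Sum>k\<in>L. cmod (c k)) \<le> 1 / cos v * sup_norm (trig_poly L c)"
      using v by (simp add: sumL field_simps)
  qed simp
  moreover have "1 / cos v \<le> C" if C: "sidon_bound L C" for C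
  proof -
    define w where "w = pi * gcd p q / (p + q)"
    \<comment> \<open>The extremal polynomial: its coefficient moduli sum to
      \<open>2 * (p + q)\<close>, while its sup norm is at most
      \<open>2 * (p + q) * cos v\<close>.\<close>
    define c where "c k = (if k = l0 then of_int q * cis w else
       if k = l1 then of_int (p + q) else of_int p * cis w)" for k
    have c: "c l0 = of_int q * cis w" "c l1 = of_int (p + q)" "c l2 = of_int p * cis w"
      using d by (auto simp: c_def)
    have "cmod (trig_poly L c t) \<le> 2 * (p + q) * cos v" for t
    proof -
      have "cmod (trig_poly L c t)
          = cmod (of_int q * cis (w - p * t) + of_int (p + q) + of_int p * cis (w + q * t))"
        unfolding poly c by (simp add: mult.assoc cis_mult)
      also have "\<dots> \<le> 2 * (p + q) * cos (w / 2)"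
        unfolding w_def by (rule extremal_trinomial_le[OF pos])
      also have "w / 2 = v"
        by (simp add: w_def v_def)
      finally show ?thesis .
    qed
    then have up: "sup_norm (trig_poly L c) \<le> 2 * (p + q) * cos v"
      unfolding sup_norm_def by (intro cSUP_least) auto
    have "0 \<le> cmod (trig_poly L c 0)"
      by simp
    also have "\<dots> \<le> sup_norm (trig_poly L c)"
      by (rule sup_norm_upper) simp
    finally have nonneg: "0 \<le> sup_norm (trig_poly L c)" .
    have "(\<Sum>k\<in>L. cmod (c k)) = 2 * (p + q)"
      unfolding sumL c norm_mult norm_cis norm_of_int using pos by simp
    then have le: "2 * (p + q) \<le> C * sup_norm (trig_poly L c)"
      using C unfolding sidon_bound_def by (metis \<open>finite L\<close> subset_refl)
    have N: "real_of_int (p + q) > 0"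
      using pos by simp
    \<comment> \<open>The sign is needed to multiply the upper bound \<open>up\<close> by
      \<open>C\<close>.\<close>
    have "C \<ge> 0"
    proof (rule ccontr)
      assume "\<not> C \<ge> 0"
      then have "C * sup_norm (trig_poly L c) \<le> 0"
        using nonneg by (simp add: mult_nonpos_nonneg)
      then show False
        using le N by simp
    qed
    then have "2 * (p + q) \<le> C * (2 * (p + q) * cos v)"
      using le up by (meson mult_left_mono order_trans)
    then have "real_of_int (p + q) * 1 \<le> real_of_int (p + q) * (C * cos v)"
      by (simp add: algebra_simps)
    then have "1 \<le> C * cos v"
      using N by (simp only: mult_le_cancel_left_pos)
    then show ?thesis
      using v by (simp add: field_simps)
  qed
  ultimately have "is_sidon_constant L (1 / cos v)"
    by (auto simp: is_sidon_constant_def)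
  moreover have "p + q = l2 - l0"
    by (simp add: p_def q_def)
  ultimately show ?thesis
    by (simp only: v_def L_def p_def q_def)
qed

text \<open>The gcd of the differences does not depend on the base point, so the frequencies may be
  sorted.\<close>

lemma gcd_diff_swap:
  fixes x y z :: int
  shows "gcd (x - y) (z - y) = gcd (y - x) (z - x)"
proof -
  have "gcd (x - y) (z - y) = gcd (x - y) ((z - y) - (x - y))"
    by (metis gcd.commute gcd_diff1)
  also have "\<dots> = gcd (y - x) (z - x)"
    by (metis diff_diff_eq2 diff_add_cancel gcd_neg1_int minus_diff_eq)
  finally show ?thesis .
qed

theorem theorem4p3:
  fixes l0 l1 l2 :: int and n :: real
  assumes "distinct [l0, l1, l2]"
    and "n = real_of_int (Max {\<bar>a - b\<bar> | a b. a \<in> {l0, l1, l2} \<and> b \<in> {l0, l1, l2}})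
             / real_of_int (gcd (l1 - l0) (l2 - l0))"
  shows "is_sidon_constant {l0, l1, l2} (1 / cos (pi / (2 * n)))"
proof -
  obtain a b c where abc: "a < b" "b < c" "{l0, l1, l2} = {a, b, c}"
    and gcd_eq: "gcd (l1 - l0) (l2 - l0) = gcd (b - a) (c - a)"
  proof -
    consider "l0 < l1" "l1 < l2" | "l0 < l2" "l2 < l1" | "l1 < l0" "l0 < l2"
      | "l1 < l2" "l2 < l0" | "l2 < l0" "l0 < l1" | "l2 < l1" "l1 < l0"
      using assms(1) by fastforce
    then show thesis
      by cases (rule that, assumption+, force, metis gcd.commute gcd_diff_swap)+
  qed
  have "Max {\<bar>x - y\<bar> | x y. x \<in> {l0, l1, l2} \<and> y \<in> {l0, l1, l2}} = c - a"
    unfolding abc(3)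
  proof (rule Max_eqI)
    have "{\<bar>x - y\<bar> | x y. x \<in> {a, b, c} \<and> y \<in> {a, b, c}}
        = (\<lambda>(x, y). \<bar>x - y\<bar>) ` ({a, b, c} \<times> {a, b, c})"
      by auto
    then show "finite {\<bar>x - y\<bar> | x y. x \<in> {a, b, c} \<and> y \<in> {a, b, c}}"
      by simp
    have "c - a = \<bar>c - a\<bar>"
      using abc by simp
    then show "c - a \<in> {\<bar>x - y\<bar> | x y. x \<in> {a, b, c} \<and> y \<in> {a, b, c}}"
      by blast
  qed (use abc(1,2) in auto)
  moreover have "gcd (b - a) (c - a) = gcd (b - a) (c - b)"
    by (metis diff_diff_eq2 diff_add_cancel gcd.commute gcd_diff1)
  ultimately have "pi / (2 * n) = pi * gcd (b - a) (c - b) / (2 * (c - a))"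
    using assms(2) gcd_eq by simp
  then show ?thesis
    using is_sidon_constant_ordered[OF abc(1,2)] abc(3) by simp
qed

end
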